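(* Let $k_1<k_2$ be real numbers. If $\mathbb{Q}=Q_1\cup\ldots\cup Q_r$ with $r\in\mathbb{N}$, then there exists $1\leq i_0\leq r$ such that the set $Q_{i_0}$ has the following property: for every $k\in\mathbb{N}$ there exist $\alpha\in\mathbb{Q}$, $\beta\in\mathbb{Q}\setminus\mathbb{Z}$ and $\gamma\in\mathbb{Z}^\ast$ with $dom^+(\beta)=\emptyset=dom^-(\gamma)$ and $\max dom^-(\beta)<k_1<k_2<\min dom^+(\gamma)$ such that $\alpha+p\beta+q\gamma\in Q_{i_0}$ for all integers $0\leq p,q\leq k$.
   Context: Notation: $\mathbb{N}=\{1,2,\ldots\}$, $\mathbb{Z}^\ast=\mathbb{Z}\setminus\{0\}$. Expansion of rationals: every rational number $q$ has a unique expression $q=\sum_{s=1}^{\infty}q_{-s}\frac{(-1)^{s}}{(s+1)!}+\sum_{r=1}^{\infty}q_{r}(-1)^{r+1}r!$ with integers $0\leq q_{-s}\leq s$ for $s\geq 1$ and $0\leq q_r\leq r$ for $r\geq 1$, all but finitely many of which are zero. Put $dom(q)=\{t\in\mathbb{Z}^\ast: q_t\neq 0\}$, $dom^-(q)=\{t\in dom(q): t<0\}$, $dom^+(q)=\{t\in dom(q): t>0\}$. *)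

theory Defs
  imports Complex_Main
begin

text \<open>
  The digits of a rational number form one function \<open>d :: int \<Rightarrow> int\<close>; the index set is the nonzero
  integers, and the convention \<open>d 0 = 0\<close> pins down the irrelevant value at \<open>0\<close>. The sums have
  only finitely many nonzero terms and are taken over their supports.
\<close>

definition is_expansion :: "rat \<Rightarrow> (int \<Rightarrow> int) \<Rightarrow> bool" where
  "is_expansion q d \<longleftrightarrow>
     d 0 = 0 \<and> finite {t. d t \<noteq> 0} \<and>
     (\<forall>s::nat. s \<ge> 1 \<longrightarrow> 0 \<le> d (- int s) \<and> d (- int s) \<le> int s) \<and>
     (\<forall>r::nat. r \<ge> 1 \<longrightarrow> 0 \<le> d (int r) \<and> d (int r) \<le> int r) \<and>
     q = (\<Sum>s | s \<ge> 1 \<and> d (- int s) \<noteq> 0. of_int (d (- int s)) * ((-1) ^ s / fact (s + 1)))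
       + (\<Sum>r | r \<ge> 1 \<and> d (int r) \<noteq> 0. of_int (d (int r)) * (-1) ^ (r + 1) * fact r)"

definition digit :: "rat \<Rightarrow> int \<Rightarrow> int" where
  "digit q = (THE d. is_expansion q d)"

definition rat_dom :: "rat \<Rightarrow> int set" where
  "rat_dom q = {t. t \<noteq> 0 \<and> digit q t \<noteq> 0}"

definition rat_dom_neg :: "rat \<Rightarrow> int set" where
  "rat_dom_neg q = {t \<in> rat_dom q. t < 0}"

definition rat_dom_pos :: "rat \<Rightarrow> int set" where
  "rat_dom_pos q = {t \<in> rat_dom q. t > 0}"


subsection \<open>Existence and uniqueness of the expansion\<close>

lemma neg_part_exists:
  "\<exists>d m. (\<forall>s. 0 \<le> d s \<and> d s \<le> int s) \<and> (\<forall>s>N. d s = 0) \<and>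
     (of_int a / fact (N + 1) :: rat)
       = of_int m + (\<Sum>s=1..N. of_int (d s) * ((-1) ^ s / fact (s + 1)))"
proof (induction N arbitrary: a)
  case 0
  show ?case by (rule exI[of _ "\<lambda>_. 0"], rule exI[of _ a]) simp
next
  case (Suc N)
  define \<sigma> :: int where "\<sigma> = (-1) ^ Suc N"
  define e where "e = (\<sigma> * a) mod int (N + 2)"
  define b where "b = \<sigma> * ((\<sigma> * a) div int (N + 2))"
  have \<sigma>2: "\<sigma> * \<sigma> = 1" by (simp add: \<sigma>_def flip: power_mult_distrib)
  have "\<sigma> * a = e + int (N + 2) * ((\<sigma> * a) div int (N + 2))" by (simp add: e_def)
  then have "\<sigma> * (\<sigma> * a) = \<sigma> * (e + int (N + 2) * ((\<sigma> * a) div int (N + 2)))" by simp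
  then have "(\<sigma> * \<sigma>) * a = \<sigma> * e + int (N + 2) * b"
    unfolding b_def by (simp only: algebra_simps)
  with \<sigma>2 have a: "a = \<sigma> * e + int (N + 2) * b" by simp
  have e: "0 \<le> e" "e \<le> int (Suc N)"
    using pos_mod_bound[of "int (N + 2)" "\<sigma> * a"] by (simp_all add: e_def del: pos_mod_bound)
  obtain d m where d: "\<forall>s. 0 \<le> d s \<and> d s \<le> int s" "\<forall>s>N. d s = 0"
    "(of_int b / fact (N + 1) :: rat)
       = of_int m + (\<Sum>s=1..N. of_int (d s) * ((-1) ^ s / fact (s + 1)))"
    using Suc.IH by meson
  have f: "(fact (Suc N + 1) :: rat) = of_int (int (N + 2)) * fact (N + 1)" by simp
  have "(of_int a / fact (Suc N + 1) :: rat)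
      = of_int \<sigma> * of_int e / fact (Suc N + 1) + of_int (int (N + 2)) * of_int b / fact (Suc N + 1)"
    by (subst a) (simp only: of_int_add of_int_mult add_divide_distrib)
  also have "of_int (int (N + 2)) * of_int b / (fact (Suc N + 1) :: rat) = of_int b / fact (N + 1)"
    unfolding f by (rule mult_divide_mult_cancel_left) simp
  finally have "(of_int a / fact (Suc N + 1) :: rat)
      = of_int m + (\<Sum>s=1..Suc N. of_int ((d(Suc N := e)) s) * ((-1) ^ s / fact (s + 1)))"
    using d(3) by (simp add: \<sigma>_def)
  moreover have "\<forall>s. 0 \<le> (d(Suc N := e)) s \<and> (d(Suc N := e)) s \<le> int s"
    "\<forall>s>Suc N. (d(Suc N := e)) s = 0"
    using d(1,2) e by auto
  ultimately show ?case by blast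
qed

lemma pos_part_exists:
  assumes "j \<ge> 1"
  shows "\<exists>d M. (\<forall>r. 0 \<le> d r \<and> d r \<le> int r) \<and> (\<forall>r. r < j \<or> r > M \<longrightarrow> d r = 0) \<and>
     n * (-1) ^ (j + 1) * fact j = (\<Sum>r=1..M. d r * (-1) ^ (r + 1) * fact r)"
  using assms
proof (induction "nat (2 * \<bar>n\<bar> + (if n < 0 then 1 else 0))" arbitrary: n j rule: less_induct)
  case less
  show ?case
  proof (cases "n = 0")
    case True
    then show ?thesis by (intro exI[of _ "\<lambda>_. 0"]) simp
  next
    case False
    define e where "e = n mod int (j + 1)"
    define n' where "n' = - (n div int (j + 1))"
    have n: "n = e - int (j + 1) * n'" by (simp add: e_def n'_def)
    have e: "0 \<le> e" "e \<le> int j"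
      using pos_mod_bound[of "int (j + 1)" n] by (simp_all add: e_def del: pos_mod_bound)
    have "2 * \<bar>n'\<bar> + (if n' < 0 then 1 else 0) < 2 * \<bar>n\<bar> + (if n < 0 then 1 else 0)"
    proof (cases "n > 0")
      case True
      then have "n div int (j + 1) \<ge> 0" by (simp add: pos_imp_zdiv_nonneg_iff)
      then have "n' \<le> 0" by (simp add: n'_def)
      moreover have "int (j + 1) * (- n') \<ge> 2 * (- n')"
        using \<open>n' \<le> 0\<close> less.prems by (intro mult_right_mono) auto
      ultimately show ?thesis using n e True by (auto simp: algebra_simps)
    next
      case False
      with \<open>n \<noteq> 0\<close> have "n < 0" by simp
      then have "n div int (j + 1) < 0" by (simp add: div_neg_pos_less0)
      then have "n' \<ge> 1" by (simp add: n'_def)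
      have "int (j + 1) * (n' - 1) \<ge> 2 * (n' - 1)"
        using \<open>n' \<ge> 1\<close> less.prems by (intro mult_right_mono) auto
      then have "int (j + 1) * n' - int j \<ge> 2 * n' - 1" by (simp add: algebra_simps)
      with n e have "- n \<ge> 2 * n' - 1" by linarith
      with \<open>n < 0\<close> \<open>n' \<ge> 1\<close> show ?thesis by simp
    qed
    moreover have "2 * \<bar>n'\<bar> + (if n' < 0 then 1 else 0) \<ge> 0" by simp
    ultimately have "nat (2 * \<bar>n'\<bar> + (if n' < 0 then 1 else 0))
        < nat (2 * \<bar>n\<bar> + (if n < 0 then 1 else 0))" by linarith
    from less.hyps[OF this, of "Suc j"] obtain d M where
      d: "\<forall>r. 0 \<le> d r \<and> d r \<le> int r" "\<forall>r. r < Suc j \<or> r > M \<longrightarrow> d r = 0"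
        "n' * (-1) ^ (Suc j + 1) * fact (Suc j) = (\<Sum>r=1..M. d r * (-1) ^ (r + 1) * fact r)"
      by auto
    let ?M = "max M j" and ?d = "d(j := e)"
    have "(\<Sum>r=1..M. d r * (-1) ^ (r + 1) * fact r) = (\<Sum>r=1..?M. d r * (-1) ^ (r + 1) * fact r)"
      using d(2) by (intro sum.mono_neutral_left) auto
    also have "\<dots> = (\<Sum>r\<in>{1..?M} - {j}. ?d r * (-1) ^ (r + 1) * fact r)"
      using d(2) by (intro sum.mono_neutral_cong_right) auto
    finally have "(\<Sum>r=1..?M. ?d r * (-1) ^ (r + 1) * fact r)
        = e * (-1) ^ (j + 1) * fact j + n' * (-1) ^ (Suc j + 1) * fact (Suc j)"
      using d(3) less.prems by (subst sum.remove[of _ j]) auto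
    also have "\<dots> = n * (-1) ^ (j + 1) * fact j"
      by (subst n) (simp add: algebra_simps)
    finally have "n * (-1) ^ (j + 1) * fact j = (\<Sum>r=1..?M. ?d r * (-1) ^ (r + 1) * fact r)" ..
    moreover have "\<forall>r. 0 \<le> ?d r \<and> ?d r \<le> int r" "\<forall>r. r < j \<or> r > ?M \<longrightarrow> ?d r = 0"
      using d(1,2) e by auto
    ultimately show ?thesis by blast
  qed
qed

lemma small_multiple_zero:
  fixes x m :: int
  assumes "m dvd x" "\<bar>x\<bar> < m"
  shows "x = 0"
  using assms zdvd_imp_le[of m "\<bar>x\<bar>"] by (cases "x = 0") auto

lemma neg_part_step:
  "(\<Sum>s=1..Suc N. of_int (f s) * ((-1) ^ s / fact (s + 1))) * (fact (Suc N + 1) :: rat)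
    = of_nat (N + 2) * ((\<Sum>s=1..N. of_int (f s) * ((-1) ^ s / fact (s + 1))) * fact (N + 1))
      + of_int (f (Suc N)) * (-1) ^ Suc N" (is "?S (Suc N) * _ = _ * (?S N * _) + _")
proof -
  have "?S (Suc N) = ?S N + of_int (f (Suc N)) * ((-1) ^ Suc N / fact (Suc N + 1) :: rat)"
    by (simp del: fact_Suc)
  then have "?S (Suc N) * (fact (Suc N + 1) :: rat)
      = ?S N * fact (Suc N + 1) + of_int (f (Suc N)) * ((-1) ^ Suc N / fact (Suc N + 1)) * fact (Suc N + 1)"
    by (simp only: distrib_right)
  moreover have "?S N * (fact (Suc N + 1) :: rat) = of_nat (N + 2) * (?S N * fact (N + 1))"
    by (subst add_Suc, subst fact_Suc) (simp only: mult_ac add_2_eq_Suc' add_Suc Suc_eq_plus1)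
  moreover have "of_int (f (Suc N)) * ((-1) ^ Suc N / fact (Suc N + 1)) * (fact (Suc N + 1) :: rat)
      = of_int (f (Suc N)) * (-1) ^ Suc N"
    using fact_nonzero[of "Suc N + 1", where 'a = rat]
    by (simp only: times_divide_eq_right nonzero_divide_eq_eq[symmetric] nonzero_mult_div_cancel_right
        times_divide_eq_left not_False_eq_True)
  ultimately show ?thesis by (simp only:)
qed

lemma neg_part_scaled_int:
  "(\<Sum>s=1..N. of_int (f s) * ((-1) ^ s / fact (s + 1))) * (fact (N + 1) :: rat) \<in> \<int>"
proof (induction N)
  case (Suc N)
  have "(\<Sum>s=1..Suc N. of_int (f s) * ((-1) ^ s / fact (s + 1))) * (fact (Suc N + 1) :: rat)
      = of_nat (N + 2) * ((\<Sum>s=1..N. of_int (f s) * ((-1) ^ s / fact (s + 1))) * fact (N + 1))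
        + of_int (f (Suc N)) * (-1) ^ Suc N"
    by (rule neg_part_step)
  also have "\<dots> \<in> \<int>" by (intro Ints_add Ints_mult[OF Ints_of_nat Suc]) auto
  finally show ?case .
qed simp

lemma neg_part_unique:
  fixes f :: "nat \<Rightarrow> int"
  assumes "\<And>s. \<bar>f s\<bar> \<le> int s"
    and "(\<Sum>s=1..N. of_int (f s) * ((-1) ^ s / fact (s + 1)) :: rat) \<in> \<int>"
  shows "s \<in> {1..N} \<Longrightarrow> f s = 0"
  using assms(2)
proof (induction N)
  case (Suc N)
  let ?S = "\<lambda>N. (\<Sum>s=1..N. of_int (f s) * ((-1) ^ s / fact (s + 1)) :: rat)"
  obtain m where m: "?S (Suc N) = of_int m" using Suc.prems(2) by (elim Ints_cases)
  obtain l where l: "?S N * fact (N + 1) = of_int l"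
    using neg_part_scaled_int[of f N] by (elim Ints_cases)
  have "of_int m * (fact (Suc N + 1) :: rat)
      = of_nat (N + 2) * (?S N * fact (N + 1)) + of_int (f (Suc N)) * (-1) ^ Suc N"
    unfolding m[symmetric] by (rule neg_part_step)
  then have "(of_int (m * fact (Suc N + 1)) :: rat)
      = of_int (int (N + 2) * l + f (Suc N) * (-1) ^ Suc N)"
    unfolding l by simp
  then have "m * fact (Suc N + 1) = int (N + 2) * l + f (Suc N) * (-1) ^ Suc N"
    by (simp only: of_int_eq_iff)
  moreover have "fact (Suc N + 1) = int (N + 2) * fact (N + 1)" by simp
  ultimately have "f (Suc N) * (-1) ^ Suc N = int (N + 2) * (m * fact (N + 1) - l)"
    by (simp only: algebra_simps)
  then have "int (N + 2) dvd f (Suc N) * (-1) ^ Suc N" by (rule dvdI)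
  then have "int (N + 2) dvd f (Suc N)" by (cases "even N") auto
  then have 0: "f (Suc N) = 0"
    using assms(1)[of "Suc N"] by (intro small_multiple_zero[of "int (N + 2)"]) auto
  then have "?S N \<in> \<int>" using Suc.prems(2) by simp
  then show ?case using Suc.IH Suc.prems(1) 0 by (cases "s = Suc N") auto
qed simp

lemma pos_part_unique:
  fixes f :: "nat \<Rightarrow> int"
  assumes "\<And>r. \<bar>f r\<bar> \<le> int r"
    and "(\<Sum>r=1..M. f r * (-1) ^ (r + 1) * fact r) = 0"
    and "r \<in> {1..M}"
  shows "f r = 0"
proof (rule ccontr)
  assume "f r \<noteq> 0"
  define j where "j = (LEAST r. r \<in> {1..M} \<and> f r \<noteq> 0)"
  have j: "j \<in> {1..M} \<and> f j \<noteq> 0"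
    unfolding j_def by (rule LeastI[of _ r]) (use assms(3) \<open>f r \<noteq> 0\<close> in auto)
  have least: "f i = 0" if "i \<in> {1..M}" "i < j" for i
    using not_less_Least[of i] that unfolding j_def by auto
  have "(fact (j + 1) :: int) dvd (\<Sum>r\<in>{1..M} - {j}. f r * (-1) ^ (r + 1) * fact r)"
  proof (rule dvd_sum)
    fix i assume i: "i \<in> {1..M} - {j}"
    show "(fact (j + 1) :: int) dvd f i * (-1) ^ (i + 1) * fact i"
    proof (cases "i < j")
      case True
      then show ?thesis using least i by auto
    next
      case False
      then have "(fact (j + 1) :: int) dvd fact i" using i by (intro fact_dvd) auto
      then show ?thesis by (rule dvd_mult)
    qed
  qed
  moreover have "f j * (-1) ^ (j + 1) * fact j
      = - (\<Sum>r\<in>{1..M} - {j}. f r * (-1) ^ (r + 1) * fact r)"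
    using assms(2) j by (subst (asm) sum.remove[of _ j]) auto
  ultimately have "(fact (j + 1) :: int) dvd f j * (-1) ^ (j + 1) * fact j"
    by (simp only: dvd_minus_iff)
  moreover have "(fact (j + 1) :: int) = int (j + 1) * fact j" by simp
  ultimately have "int (j + 1) dvd f j * (-1) ^ (j + 1)"
    by (simp only: dvd_mult_cancel_right) simp
  then have "int (j + 1) dvd f j" by (cases "even j") auto
  then have "f j = 0"
    using assms(1)[of j] by (intro small_multiple_zero[of "int (j + 1)"]) auto
  with j show False by simp
qed

lemma is_expansion_bounded:
  assumes "d 0 = 0" "\<And>t. \<bar>t\<bar> > int N \<Longrightarrow> d t = 0"
  shows "is_expansion q d \<longleftrightarrow>
     (\<forall>s::nat. 0 \<le> d (- int s) \<and> d (- int s) \<le> int s) \<and>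
     (\<forall>r::nat. 0 \<le> d (int r) \<and> d (int r) \<le> int r) \<and>
     q = (\<Sum>s=1..N. of_int (d (- int s)) * ((-1) ^ s / fact (s + 1)))
       + of_int (\<Sum>r=1..N. d (int r) * (-1) ^ (r + 1) * fact r)"
proof -
  have "{t. d t \<noteq> 0} \<subseteq> {- int N..int N}" using assms(2) by force
  then have "finite {t. d t \<noteq> 0}" by (rule finite_subset) simp
  moreover have "(\<Sum>s | s \<ge> 1 \<and> d (- int s) \<noteq> 0. of_int (d (- int s)) * ((-1) ^ s / fact (s + 1)))
      = (\<Sum>s=1..N. of_int (d (- int s)) * ((-1) ^ s / fact (s + 1)) :: rat)"
    by (rule sum.mono_neutral_left) (use assms(2) in \<open>force+\<close>)
  moreover have "(\<Sum>r | r \<ge> 1 \<and> d (int r) \<noteq> 0. of_int (d (int r)) * (-1) ^ (r + 1) * fact r)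
      = (\<Sum>r=1..N. of_int (d (int r)) * (-1) ^ (r + 1) * fact r :: rat)"
    by (rule sum.mono_neutral_left) (use assms(2) in \<open>force+\<close>)
  moreover have "(\<forall>s::nat. P s (d (- int s))) \<longleftrightarrow> P 0 0 \<and> (\<forall>s\<ge>1. P s (d (- int s)))"
    "(\<forall>s::nat. P s (d (int s))) \<longleftrightarrow> P 0 0 \<and> (\<forall>s\<ge>1. P s (d (int s)))" for P
    using assms(1) by (metis less_one not_less of_nat_0 neg_0_equal_iff_equal)+
  note this[of "\<lambda>s x. 0 \<le> x \<and> x \<le> int s"]
  ultimately show ?thesis
    unfolding is_expansion_def using assms(1) by simp
qed

lemma is_expansion_exists: "\<exists>d. is_expansion q d"
proof -
  obtain u v where uv: "q = of_int u / of_int v" "v > 0"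
    by (metis quotient_of_denom_pos quotient_of_div surj_pair)
  define N where "N = nat v"
  have "N dvd fact (N + 1)" using uv(2) by (intro dvd_fact) (auto simp: N_def)
  then have "int N dvd fact (N + 1)" by (metis of_nat_dvd_iff of_nat_fact)
  then obtain w where w: "fact (N + 1) = v * w" using uv(2) by (auto simp: N_def elim: dvdE)
  have "w \<noteq> 0" using w fact_nonzero[of "N + 1", where 'a = int] by auto
  have "q = of_int (u * w) / of_int (v * w)" using uv \<open>w \<noteq> 0\<close> by simp
  also have "of_int (v * w) = (fact (N + 1) :: rat)" unfolding w[symmetric] by (rule of_int_fact)
  finally have q: "q = of_int (u * w) / fact (N + 1)" .
  obtain d m where d: "\<forall>s. 0 \<le> d s \<and> d s \<le> int s" "\<forall>s>N. d s = 0"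
    "q = of_int m + (\<Sum>s=1..N. of_int (d s) * ((-1) ^ s / fact (s + 1)))"
    using neg_part_exists[of N "u * w"] unfolding q by blast
  obtain e M where e: "\<forall>r. 0 \<le> e r \<and> e r \<le> int r" "\<forall>r. r < 1 \<or> r > M \<longrightarrow> e r = 0"
    "m * (-1) ^ (1 + 1) * fact 1 = (\<Sum>r=1..M. e r * (-1) ^ (r + 1) * fact r)"
    using pos_part_exists[of 1 m] by blast
  define c where "c t = (if t < 0 then d (nat (- t)) else e (nat t))" for t :: int
  define K where "K = max M N"
  have c: "c (int r) = e r" "c (- int r) = d r" for r
    using d(1)[rule_format, of 0] e(1)[rule_format, of 0] by (auto simp: c_def)
  have "(\<Sum>s=1..N. of_int (d s) * ((-1) ^ s / fact (s + 1)))
      = (\<Sum>s=1..K. of_int (d s) * ((-1) ^ s / fact (s + 1)) :: rat)"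
    by (rule sum.mono_neutral_left) (use d(2) in \<open>auto simp: K_def\<close>)
  moreover have "(\<Sum>r=1..M. e r * (-1) ^ (r + 1) * fact r) = (\<Sum>r=1..K. e r * (-1) ^ (r + 1) * fact r)"
    by (rule sum.mono_neutral_left) (use e(2) in \<open>auto simp: K_def\<close>)
  ultimately have "q = (\<Sum>s=1..K. of_int (c (- int s)) * ((-1) ^ s / fact (s + 1)))
       + of_int (\<Sum>r=1..K. c (int r) * (-1) ^ (r + 1) * fact r)"
    using d(3) e(3) by (simp add: c)
  moreover have "c 0 = 0" using e(2) by (simp add: c_def)
  moreover have "c t = 0" if "\<bar>t\<bar> > int K" for t
    using that d(2) e(2) by (auto simp: c_def K_def)
  ultimately have "is_expansion q c"
    by (subst is_expansion_bounded[of _ K]) (use d(1) e(1) in \<open>simp_all add: c\<close>)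
  then show ?thesis by blast
qed

lemma is_expansion_unique:
  assumes "is_expansion q d" "is_expansion q d'"
  shows "d = d'"
proof -
  have fin: "finite ({t. d t \<noteq> 0} \<union> {t. d' t \<noteq> 0})" and zero: "d 0 = 0" "d' 0 = 0"
    using assms by (auto simp: is_expansion_def)
  obtain N where N: "\<And>t. t \<in> {t. d t \<noteq> 0} \<union> {t. d' t \<noteq> 0} \<Longrightarrow> \<bar>t\<bar> \<le> int N"
  proof -
    let ?A = "(\<lambda>t. nat \<bar>t\<bar>) ` ({t. d t \<noteq> 0} \<union> {t. d' t \<noteq> 0})"
    have "\<And>x. x \<in> ?A \<Longrightarrow> x \<le> Max (insert 0 ?A)" using fin by (intro Max_ge) auto
    then show ?thesis by (intro that[of "Max (insert 0 ?A)"]) force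
  qed
  then have big: "\<And>t. \<bar>t\<bar> > int N \<Longrightarrow> d t = 0" "\<And>t. \<bar>t\<bar> > int N \<Longrightarrow> d' t = 0" by force+
  note E = is_expansion_bounded[of d N, OF zero(1) big(1), THEN iffD1, OF _ assms(1)]
    and E' = is_expansion_bounded[of d' N, OF zero(2) big(2), THEN iffD1, OF _ assms(2)]
  define f where "f s = d (- int s) - d' (- int s)" for s :: nat
  define g where "g r = d (int r) - d' (int r)" for r :: nat
  have fb: "\<bar>f s\<bar> \<le> int s" for s
    using conjunct1[OF E, rule_format, of s] conjunct1[OF E', rule_format, of s] by (simp add: f_def abs_le_iff)
  have gb: "\<bar>g r\<bar> \<le> int r" for r
    using E[THEN conjunct2, THEN conjunct1, rule_format, of r]
      E'[THEN conjunct2, THEN conjunct1, rule_format, of r] by (simp add: g_def abs_le_iff)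
  let ?A = "\<lambda>d. \<Sum>s=1..N. of_int (d (- int s)) * ((-1) ^ s / fact (s + 1)) :: rat"
    and ?B = "\<lambda>d. \<Sum>r=1..N. d (int r) * (-1) ^ (r + 1) * fact r :: int"
  have "(\<Sum>s=1..N. of_int (f s) * ((-1) ^ s / fact (s + 1))) = ?A d - ?A d'"
    by (simp only: f_def of_int_diff left_diff_distrib sum_subtractf)
  moreover have "(\<Sum>r=1..N. g r * (-1) ^ (r + 1) * fact r) = ?B d - ?B d'"
    by (simp only: g_def left_diff_distrib sum_subtractf)
  moreover have "?A d + of_int (?B d) = ?A d' + of_int (?B d')"
    using E[THEN conjunct2, THEN conjunct2] E'[THEN conjunct2, THEN conjunct2] by (rule subst)
  ultimately have sum0: "(\<Sum>s=1..N. of_int (f s) * ((-1) ^ s / fact (s + 1)))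
      + of_int (\<Sum>r=1..N. g r * (-1) ^ (r + 1) * fact r) = (0 :: rat)"
    by (simp only: of_int_diff)
  then have "(\<Sum>s=1..N. of_int (f s) * ((-1) ^ s / fact (s + 1)) :: rat)
      = of_int (- (\<Sum>r=1..N. g r * (-1) ^ (r + 1) * fact r))"
    by (simp add: add_eq_0_iff2)
  then have f0: "f s = 0" if "s \<in> {1..N}" for s
    using neg_part_unique[OF fb _ that] Ints_of_int by metis
  have "(\<Sum>r=1..N. g r * (-1) ^ (r + 1) * fact r) = 0"
  proof -
    have "(\<Sum>s=1..N. of_int (f s) * ((-1) ^ s / fact (s + 1)) :: rat) = 0"
      using f0 by (intro sum.neutral) simp
    with sum0 show ?thesis by (simp only: add_0 of_int_eq_0_iff)
  qed
  then have g0: "g r = 0" if "r \<in> {1..N}" for r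
    using pos_part_unique[OF gb _ that] by blast
  show ?thesis
  proof
    fix t
    consider "\<bar>t\<bar> > int N" | "t = 0" | s where "t = - int s" "s \<in> {1..N}" | r where "t = int r" "r \<in> {1..N}"
    proof -
      assume a: "\<bar>t\<bar> > int N \<Longrightarrow> thesis" "t = 0 \<Longrightarrow> thesis"
        "\<And>s. t = - int s \<Longrightarrow> s \<in> {1..N} \<Longrightarrow> thesis" "\<And>r. t = int r \<Longrightarrow> r \<in> {1..N} \<Longrightarrow> thesis"
      show thesis using a(1,2) a(3)[of "nat (- t)"] a(4)[of "nat t"] by (cases "t < 0") force+
    qed
    then show "d t = d' t"
      using big zero f0 g0 by cases (auto simp: f_def g_def)
  qed
qed

theorem is_expansion_ex1: "\<exists>!d. is_expansion q d"
  using is_expansion_exists is_expansion_unique by blast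

lemma is_expansion_digit: "is_expansion q (digit q)"
  unfolding digit_def by (rule theI'[OF is_expansion_ex1])

text \<open>
  The maximum of \<open>rat_dom_neg \<beta>\<close> for \<open>\<beta> \<notin> \<int>\<close> and the minimum of \<open>rat_dom_pos \<gamma>\<close> for \<open>\<gamma> \<noteq> 0\<close> with
  \<open>rat_dom_neg \<gamma> = {}\<close> are taken over finite nonempty sets.
\<close>

lemma finite_rat_dom: "finite (rat_dom q)"
proof (rule finite_subset)
  show "finite {t. digit q t \<noteq> 0}"
    by (rule is_expansion_digit[of q, unfolded is_expansion_def, THEN conjunct2, THEN conjunct1])
qed (auto simp: rat_dom_def)

lemma finite_rat_dom_neg: "finite (rat_dom_neg q)"
  and finite_rat_dom_pos: "finite (rat_dom_pos q)"
  unfolding rat_dom_neg_def rat_dom_pos_def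
  by (rule finite_subset[OF _ finite_rat_dom[of q]], blast)+

lemma digit_neg_mem: "s \<ge> 1 \<Longrightarrow> digit q (- int s) \<noteq> 0 \<Longrightarrow> - int s \<in> rat_dom_neg q"
  and digit_pos_mem: "s \<ge> 1 \<Longrightarrow> digit q (int s) \<noteq> 0 \<Longrightarrow> int s \<in> rat_dom_pos q"
  by (simp_all add: rat_dom_neg_def rat_dom_pos_def rat_dom_def)

lemma rat_dom_neg_nonempty:
  assumes "q \<notin> \<int>"
  shows "rat_dom_neg q \<noteq> {}"
proof
  note q = is_expansion_digit[of q, unfolded is_expansion_def,
    THEN conjunct2, THEN conjunct2, THEN conjunct2, THEN conjunct2]
  assume e: "rat_dom_neg q = {}"
  have n: "{s::nat. s \<ge> 1 \<and> digit q (- int s) \<noteq> 0} = {}"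
    using e digit_neg_mem by blast
  have "of_int (\<Sum>r | r \<ge> 1 \<and> digit q (int r) \<noteq> 0. digit q (int r) * (-1) ^ (r + 1) * fact r) \<in> (\<int> :: rat set)"
    by (rule Ints_of_int)
  then have "q \<in> \<int>"
    by (subst q) (simp only: n sum.empty add_0 of_int_sum of_int_mult of_int_power of_int_minus of_int_1 of_int_fact)
  with assms show False by contradiction
qed

lemma rat_dom_pos_nonempty:
  assumes "q \<noteq> 0" "rat_dom_neg q = {}"
  shows "rat_dom_pos q \<noteq> {}"
proof
  note q = is_expansion_digit[of q, unfolded is_expansion_def,
    THEN conjunct2, THEN conjunct2, THEN conjunct2, THEN conjunct2]
  assume e: "rat_dom_pos q = {}"
  have n: "{s::nat. s \<ge> 1 \<and> digit q (- int s) \<noteq> 0} = {}"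
    using assms(2) digit_neg_mem by blast
  have p: "{r::nat. r \<ge> 1 \<and> digit q (int r) \<noteq> 0} = {}"
    using e digit_pos_mem by blast
  have "q = 0"
    by (subst q) (simp only: n p sum.empty add_0)
  with assms(1) show False by contradiction
qed

end

theory Submission
  imports Defs "HOL-Library.FuncSet"
begin

text \<open>
  A positive integer \<open>d \<le> s\<close> is itself a digit, so \<open>d (-1)\<^sup>s / (s + 1)!\<close> has domain \<open>{- s}\<close>
  and \<open>d (-1)\<^sup>s\<^sup>+\<^sup>1 s!\<close> has domain \<open>{s}\<close>. Hence it suffices to find, for a finite colouring of
  the lattice spanned by two such units with \<open>s\<close> large, a monochromatic grid whose two step widths
  are bounded in terms of \<open>k\<close> and the number of colours alone. Such grids come from applying
  van der Waerden's theorem in one coordinate to the colouring by whole segments in the other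
  coordinate, and then once more inside a segment. The colour can be chosen independently of
  \<open>k\<close> since a larger grid contains the smaller ones.
\<close>

section \<open>Van der Waerden's theorem\<close>

text \<open>The clause \<open>d \<le> W\<close> matters only for \<open>k = 0\<close>.\<close>

definition vdw_bound :: "nat \<Rightarrow> 'a set \<Rightarrow> nat \<Rightarrow> bool" where
  "vdw_bound k C W \<longleftrightarrow> (\<forall>f::nat \<Rightarrow> 'a. range f \<subseteq> C \<longrightarrow>
     (\<exists>a d. 0 < d \<and> d \<le> W \<and> a + k * d \<le> W \<and> (\<forall>i\<le>k. f (a + i * d) = f a)))"

text \<open>Colours matter only through equality, so a bijection of \<open>C\<close> onto
  \<open>{..<card C}\<close> suffices. This admits colours that are themselves colourings of a
  window.\<close>

lemma vdw_bound_transfer: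
  fixes C :: "'a set"
  assumes "\<And>r. \<exists>W. vdw_bound k {..<r::nat} W" and "finite C"
  shows "\<exists>W. vdw_bound k C W"
proof -
  obtain h where h: "bij_betw h C {..<card C}"
    using ex_bij_betw_finite_nat[OF \<open>finite C\<close>] by (auto simp: atLeast0LessThan)
  obtain W where W: "vdw_bound k {..<card C} W"
    using assms(1) by blast
  have "vdw_bound k C W"
    unfolding vdw_bound_def
  proof (intro allI impI)
    fix f :: "nat \<Rightarrow> 'a"
    assume f: "range f \<subseteq> C"
    then have "range (h \<circ> f) \<subseteq> {..<card C}"
      using bij_betw_imp_surj_on[OF h] by auto
    then obtain a d where ad: "0 < d" "d \<le> W" "a + k * d \<le> W"
      "\<forall>i\<le>k. (h \<circ> f) (a + i * d) = (h \<circ> f) a"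
      using W unfolding vdw_bound_def by meson
    have "\<forall>i\<le>k. f (a + i * d) = f a"
      using ad(4) f by (simp add: inj_on_eq_iff[OF bij_betw_imp_inj_on[OF h]] image_subset_iff)
    with ad show "\<exists>a d. 0 < d \<and> d \<le> W \<and> a + k * d \<le> W \<and> (\<forall>i\<le>k. f (a + i * d) = f a)"
      by blast
  qed
  then show ?thesis ..
qed

definition mono_ap :: "(nat \<Rightarrow> 'a) \<Rightarrow> nat \<Rightarrow> nat \<Rightarrow> bool" where
  "mono_ap f k N \<longleftrightarrow> (\<exists>a d. 0 < d \<and> a + k * d \<le> N \<and> (\<forall>i\<le>k. f (a + i * d) = f a))"

text \<open>
  The \<open>m\<close> monochromatic progressions of length \<open>k + 1\<close> have pairwise distinct colours, and the
  next term of each of them is the common focus \<open>F\<close>.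
\<close>

definition focused_aps :: "(nat \<Rightarrow> 'a) \<Rightarrow> nat \<Rightarrow> nat \<Rightarrow> nat \<Rightarrow> bool" where
  "focused_aps f k m N \<longleftrightarrow> (\<exists>S F. finite S \<and> card S = m \<and> F \<le> N \<and>
     (\<forall>c\<in>S. \<exists>a d. 0 < d \<and> a + Suc k * d = F \<and> (\<forall>i\<le>k. f (a + i * d) = c)))"

text \<open>Induction on \<open>m\<close>. The patterns on windows of \<open>N + 1\<close> numbers
  serve as colours, and the hypothesis for \<open>k\<close> gives \<open>k + 1\<close> equal windows
  in progression. In the first one, the focus either prolongs a progression of its own colour or
  contributes a new colour.\<close>

lemma colour_focusing:
  fixes r k m :: nat
  assumes IH: "\<And>r. \<exists>W. vdw_bound k {..<r::nat} W"
  shows "\<exists>N. \<forall>f::nat \<Rightarrow> nat. range f \<subseteq> {..<r} \<longrightarrow>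
    mono_ap f (Suc k) N \<or> focused_aps f k m N"
proof (induction m)
  case 0
  show ?case unfolding focused_aps_def
    by (intro exI[of _ 0] allI impI disjI2 exI[of _ "{}"] exI[of _ 0]) simp
next
  case (Suc m)
  then obtain N where N: "\<And>f::nat \<Rightarrow> nat. range f \<subseteq> {..<r} \<Longrightarrow>
    mono_ap f (Suc k) N \<or> focused_aps f k m N"
    by meson
  obtain W where W: "vdw_bound k ({..N} \<rightarrow>\<^sub>E {..<r}) W"
    using vdw_bound_transfer[OF IH] by (meson finite_PiE finite_atMost finite_lessThan)
  show ?case
  \<comment> \<open>The new focus is \<open>a + Suc k * d + F\<close>, where
    \<open>a + k * d \<le> W\<close>, \<open>d \<le> W\<close> and \<open>F \<le> N\<close>; hence
    the second \<open>W\<close>.\<close>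
  proof (intro exI[of _ "N + 2 * W"] allI impI)
    fix f :: "nat \<Rightarrow> nat"
    assume f: "range f \<subseteq> {..<r}"
    \<comment> \<open>Restriction to \<open>{..N}\<close> puts each pattern into the finite
      extensional function space for which \<open>W\<close> was chosen.\<close>
    define g where "g x = (\<lambda>t\<in>{..N}. f (x + t))" for x
    have "range g \<subseteq> {..N} \<rightarrow>\<^sub>E {..<r}"
      using f by (auto simp: g_def image_subset_iff split: if_splits)
    then obtain a d where ad: "0 < d" "d \<le> W" "a + k * d \<le> W" "\<forall>i\<le>k. g (a + i * d) = g a"
      using W unfolding vdw_bound_def by meson
    have shift: "f (a + i * d + t) = f (a + t)" if "i \<le> k" "t \<le> N" for i t
    proof -
      have "g (a + i * d) t = g a t" using ad(4) that(1) by simp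
      then show ?thesis using that(2) by (simp add: g_def)
    qed
    have "range (\<lambda>t. f (a + t)) \<subseteq> {..<r}" using f by auto
    from N[OF this] consider
      (mono) b e where "0 < e" "b + Suc k * e \<le> N" "\<forall>i\<le>Suc k. f (a + (b + i * e)) = f (a + b)"
    | (focus) S F where "finite S" "card S = m" "F \<le> N"
        "\<forall>c\<in>S. \<exists>b e. 0 < e \<and> b + Suc k * e = F \<and> (\<forall>i\<le>k. f (a + (b + i * e)) = c)"
      unfolding mono_ap_def focused_aps_def by blast
    then show "mono_ap f (Suc k) (N + 2 * W) \<or> focused_aps f k (Suc m) (N + 2 * W)"
    proof cases
      case mono
      then show ?thesis using ad(3) unfolding mono_ap_def
        by (intro disjI1 exI[of _ "a + b"] exI[of _ e]) (auto simp: add.assoc)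
    next
      case focus
      show ?thesis
      proof (cases "f (a + F) \<in> S")
        \<comment> \<open>The focus becomes the term of index \<open>Suc k\<close> of the
          progression sharing its colour.\<close>
        case True
        then obtain b e where be: "0 < e" "b + Suc k * e = F" "\<forall>i\<le>k. f (a + (b + i * e)) = f (a + F)"
          using focus(4) by blast
        have "f (a + b + i * e) = f (a + F)" if "i \<le> Suc k" for i
          using that be(2,3) by (cases "i = Suc k") (auto simp: add.assoc)
        from this this[of 0] have "\<forall>i\<le>Suc k. f (a + b + i * e) = f (a + b)" by simp
        moreover have "a + b + Suc k * e \<le> N + 2 * W"
          using be(2) focus(3) ad(3) by simp
        ultimately show ?thesis using be(1) unfolding mono_ap_def by blast
      next
        case False
        have "\<exists>b e. 0 < e \<and> b + Suc k * e = a + Suc k * d + F \<and> (\<forall>i\<le>k. f (b + i * e) = c)"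
          if "c \<in> insert (f (a + F)) S" for c
        proof (cases "c = f (a + F)")
          case True
          \<comment> \<open>The copies of the old focus in the equal windows form the progression of
            the new colour.\<close>
          have "f (a + F + i * d) = c" if "i \<le> k" for i
            using shift[OF that focus(3)] True by (simp add: ac_simps)
          then show ?thesis using ad(1) by (intro exI[of _ "a + F"] exI[of _ d]) simp
        next
          case False
          with that focus(4) obtain b e where be: "0 < e" "b + Suc k * e = F"
            "\<forall>i\<le>k. f (a + (b + i * e)) = c"
            by blast
          \<comment> \<open>Step \<open>d + e\<close> moves one window on and, inside the window,
            one term on. Equality of the windows preserves the colour.\<close>
          have "f (a + b + i * (d + e)) = c" if "i \<le> k" for i
          proof -
            have "i * e \<le> Suc k * e" using that by (intro mult_le_mono1) simp
            then have "b + i * e \<le> N" using be(2) focus(3) by linarith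
            from shift[OF that this] have "f (a + i * d + (b + i * e)) = c"
              using be(3) that by simp
            then show ?thesis by (simp add: algebra_simps)
          qed
          then show ?thesis using be(1,2)
            by (intro exI[of _ "a + b"] exI[of _ "d + e"]) (auto simp: algebra_simps)
        qed
        moreover have "a + Suc k * d + F \<le> N + 2 * W"
          using ad(2,3) focus(3) by simp
        moreover have "finite (insert (f (a + F)) S)" "card (insert (f (a + F)) S) = Suc m"
          using focus(1,2) False by auto
        ultimately show ?thesis unfolding focused_aps_def by blast
      qed
    qed
  qed
qed

text \<open>Focusing \<open>Suc r\<close> distinct colours is impossible with \<open>r\<close>
  available, so colour focusing leaves only the longer progression.\<close>

theorem van_der_Waerden_nat: "\<exists>W. vdw_bound k {..<r::nat} W"
proof (induction k arbitrary: r)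
  case 0
  show ?case
    unfolding vdw_bound_def by (intro exI[of _ 1] allI impI exI[of _ 0]) simp
next
  case (Suc k)
  obtain N where N: "\<And>f::nat \<Rightarrow> nat. range f \<subseteq> {..<r} \<Longrightarrow>
    mono_ap f (Suc k) N \<or> focused_aps f k (Suc r) N"
    using colour_focusing[OF Suc.IH, of r "Suc r"] by meson
  have "vdw_bound (Suc k) {..<r} N"
    unfolding vdw_bound_def
  proof (intro allI impI)
    fix f :: "nat \<Rightarrow> nat"
    assume f: "range f \<subseteq> {..<r}"
    have False if "finite S" "card S = Suc r"
      "\<forall>c\<in>S. \<exists>a d. 0 < d \<and> a + Suc k * d = F \<and> (\<forall>i\<le>k. f (a + i * d) = c)" for S F
    proof -
      have "S \<subseteq> range f" using that(3) by (metis le0 rangeI subsetI)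
      then have "S \<subseteq> {..<r}" using f by blast
      from card_mono[OF _ this] that(2) show False by simp
    qed
    then have "\<not> focused_aps f k (Suc r) N" unfolding focused_aps_def by blast
    with N[OF f] obtain a d where
      ad: "0 < d" "a + Suc k * d \<le> N" "\<forall>i\<le>Suc k. f (a + i * d) = f a"
      unfolding mono_ap_def by blast
    moreover have "d \<le> N" using ad(2) by simp
    ultimately show "\<exists>a d. 0 < d \<and> d \<le> N \<and> a + Suc k * d \<le> N \<and> (\<forall>i\<le>Suc k. f (a + i * d) = f a)"
      by blast
  qed
  then show ?case ..
qed

corollary van_der_Waerden: "finite C \<Longrightarrow> \<exists>W. vdw_bound k C W"
  by (rule vdw_bound_transfer[OF van_der_Waerden_nat])

section \<open>Monochromatic grids in two dimensions\<close>

text \<open>\<open>W\<close> is uniform in \<open>f\<close>, so the digit position can be fixed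
  before the widths \<open>d\<close> and \<open>e\<close>, which later serve as digits.\<close>

lemma monochromatic_grid:
  fixes C :: "'a set" and k :: nat
  assumes "finite C"
  shows "\<exists>W. \<forall>f::nat \<Rightarrow> nat \<Rightarrow> 'a. (\<forall>x y. f x y \<in> C) \<longrightarrow>
    (\<exists>a b d e. 0 < d \<and> d \<le> W \<and> 0 < e \<and> e \<le> W \<and>
      (\<forall>i\<le>k. \<forall>j\<le>k. f (a + i * d) (b + j * e) = f a b))"
proof -
  obtain W where W: "vdw_bound k C W"
    using van_der_Waerden[OF assms] by blast
  obtain V where V: "vdw_bound k ({..W} \<rightarrow>\<^sub>E C) V"
    using van_der_Waerden assms by (meson finite_PiE finite_atMost)
  show ?thesis
  proof (rule exI[of _ "max V W"], intro allI impI)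
    fix f :: "nat \<Rightarrow> nat \<Rightarrow> 'a"
    assume f: "\<forall>x y. f x y \<in> C"
    define g where "g y = (\<lambda>x\<in>{..W}. f x y)" for y
    have "range g \<subseteq> {..W} \<rightarrow>\<^sub>E C" using f by (auto simp: g_def split: if_splits)
    then obtain b e where be: "0 < e" "e \<le> V" "\<forall>j\<le>k. g (b + j * e) = g b"
      using V unfolding vdw_bound_def by meson
    have "range (\<lambda>x. f x b) \<subseteq> C" using f by auto
    then obtain a d where ad: "0 < d" "d \<le> W" "a + k * d \<le> W" "\<forall>i\<le>k. f (a + i * d) b = f a b"
      using W unfolding vdw_bound_def by meson
    have "f (a + i * d) (b + j * e) = f a b" if "i \<le> k" "j \<le> k" for i j
    proof -
      \<comment> \<open>The first coordinate must stay in \<open>{..W}\<close>, where the segments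
        at heights \<open>b + j * e\<close> agree.\<close>
      have "i * d \<le> k * d" using that(1) by simp
      then have "a + i * d \<le> W" using ad(3) by linarith
      moreover have "g (b + j * e) (a + i * d) = g b (a + i * d)" using be(3) that(2) by simp
      ultimately show ?thesis using ad(4) that(1) by (simp add: g_def)
    qed
    with ad(1,2) be(1,2) show "\<exists>a b d e. 0 < d \<and> d \<le> max V W \<and> 0 < e \<and> e \<le> max V W \<and>
      (\<forall>i\<le>k. \<forall>j\<le>k. f (a + i * d) (b + j * e) = f a b)"
      by (meson max.coboundedI1 max.coboundedI2)
  qed
qed

section \<open>Rationals with a single digit\<close>

lemma digit_eqI: "is_expansion q d \<Longrightarrow> digit q = d"
  using is_expansion_digit is_expansion_unique by blast

text \<open>By \<open>d \<le> s\<close> the one-digit function is a legal expansion, and expansions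
  are unique.\<close>

lemma digit_single_neg:
  fixes d s :: nat
  assumes "1 \<le> s" "d \<le> s"
  shows "digit (of_nat d * ((-1) ^ s / fact (s + 1))) = (\<lambda>t. if t = - int s then int d else 0)"
proof (rule digit_eqI, subst is_expansion_bounded[of _ s])
  let ?d = "\<lambda>t. if t = - int s then int d else 0"
  have "(\<Sum>i=1..s. of_int (?d (- int i)) * ((-1) ^ i / fact (i + 1)) :: rat)
      = (\<Sum>i=1..s. if i = s then of_nat d * ((-1) ^ s / fact (s + 1)) else 0)"
    by (rule sum.cong) auto
  also have "\<dots> = of_nat d * ((-1) ^ s / fact (s + 1))"
    using assms by (simp del: fact_Suc)
  finally have 1: "(\<Sum>i=1..s. of_int (?d (- int i)) * ((-1) ^ i / fact (i + 1)))
      = (of_nat d * ((-1) ^ s / fact (s + 1)) :: rat)" .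
  have 2: "(\<Sum>i=1..s. ?d (int i) * (-1) ^ (i + 1) * fact i) = 0"
    using assms by (intro sum.neutral) auto
  show "(\<forall>i::nat. 0 \<le> ?d (- int i) \<and> ?d (- int i) \<le> int i) \<and>
     (\<forall>i::nat. 0 \<le> ?d (int i) \<and> ?d (int i) \<le> int i) \<and>
     of_nat d * ((-1) ^ s / fact (s + 1))
       = (\<Sum>i=1..s. of_int (?d (- int i)) * ((-1) ^ i / fact (i + 1)))
         + (of_int (\<Sum>i=1..s. ?d (int i) * (-1) ^ (i + 1) * fact i) :: rat)"
    unfolding 1 2 using assms by auto
qed (use assms in auto)

lemma digit_single_pos:
  fixes d s :: nat
  assumes "1 \<le> s" "d \<le> s"
  shows "digit (of_nat d * ((-1) ^ (s + 1) * fact s)) = (\<lambda>t. if t = int s then int d else 0)"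
proof (rule digit_eqI, subst is_expansion_bounded[of _ s])
  let ?d = "\<lambda>t. if t = int s then int d else 0"
  have 1: "(\<Sum>i=1..s. of_int (?d (- int i)) * ((-1) ^ i / fact (i + 1))) = (0 :: rat)"
    using assms by (intro sum.neutral) auto
  have "(\<Sum>i=1..s. ?d (int i) * (-1) ^ (i + 1) * fact i)
      = (\<Sum>i=1..s. if i = s then int d * (-1) ^ (s + 1) * fact s else 0)"
    by (rule sum.cong) auto
  also have "\<dots> = int d * (-1) ^ (s + 1) * fact s"
    using assms by simp
  finally have 2: "(\<Sum>i=1..s. ?d (int i) * (-1) ^ (i + 1) * fact i)
      = int d * (-1) ^ (s + 1) * fact s" .
  show "(\<forall>i::nat. 0 \<le> ?d (- int i) \<and> ?d (- int i) \<le> int i) \<and>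
     (\<forall>i::nat. 0 \<le> ?d (int i) \<and> ?d (int i) \<le> int i) \<and>
     of_nat d * ((-1) ^ (s + 1) * fact s)
       = (\<Sum>i=1..s. of_int (?d (- int i)) * ((-1) ^ i / fact (i + 1)))
         + (of_int (\<Sum>i=1..s. ?d (int i) * (-1) ^ (i + 1) * fact i) :: rat)"
    unfolding 1 2 using assms by auto
qed (use assms in auto)

text \<open>The domain depends on \<open>s\<close> alone, so it is known before the width
  \<open>d\<close> is.\<close>

lemma rat_dom_single_neg:
  fixes d s :: nat
  assumes "0 < d" "d \<le> s"
  defines "\<beta> \<equiv> of_nat d * ((-1) ^ s / fact (s + 1)) :: rat"
  shows "rat_dom_neg \<beta> = {- int s}" "rat_dom_pos \<beta> = {}" "\<beta> \<notin> \<int>"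
proof -
  show dom: "rat_dom_neg \<beta> = {- int s}" "rat_dom_pos \<beta> = {}"
    using digit_single_neg[of s d] assms
    by (auto simp: rat_dom_neg_def rat_dom_pos_def rat_dom_def simp del: fact_Suc)
  show "\<beta> \<notin> \<int>"
  proof
    assume \<beta>: "\<beta> \<in> \<int>"
    \<comment> \<open>If \<open>\<beta>\<close> were an integer, \<open>neg_part_unique\<close>
      would force its only digit \<open>d\<close> to vanish.\<close>
    define f where "f i = (if i = s then int d else 0)" for i
    have "(\<Sum>i=1..s. of_int (f i) * ((-1) ^ i / fact (i + 1)) :: rat)
        = (\<Sum>i=1..s. if i = s then \<beta> else 0)"
      by (rule sum.cong) (auto simp: f_def \<beta>_def)
    then have "(\<Sum>i=1..s. of_int (f i) * ((-1) ^ i / fact (i + 1)) :: rat) \<in> \<int>"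
      using \<beta> assms(1,2) by simp
    moreover have "\<bar>f i\<bar> \<le> int i" for i using assms(2) by (simp add: f_def)
    ultimately have "f s = 0" using neg_part_unique[of f s s] assms(1,2) by simp
    then show False using assms(1) by (simp add: f_def)
  qed
qed

lemma rat_dom_single_pos:
  fixes d s :: nat
  assumes "0 < d" "d \<le> s"
  defines "\<gamma> \<equiv> of_nat d * ((-1) ^ (s + 1) * fact s) :: rat"
  shows "rat_dom_pos \<gamma> = {int s}" "rat_dom_neg \<gamma> = {}" "\<gamma> \<in> \<int> - {0}"
proof -
  show "rat_dom_pos \<gamma> = {int s}" "rat_dom_neg \<gamma> = {}"
    using digit_single_pos[of s d] assms
    by (auto simp: rat_dom_neg_def rat_dom_pos_def rat_dom_def)
  have "\<gamma> = of_int (int d * ((-1) ^ (s + 1) * fact s))" by (simp add: \<gamma>_def)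
  then have "\<gamma> \<in> \<int>" by (metis Ints_of_int)
  then show "\<gamma> \<in> \<int> - {0}" using assms(1) by (simp add: \<gamma>_def)
qed

section \<open>One class for all grid sizes\<close>

text \<open>If every \<open>i\<close> failed at some \<open>h i\<close>, then by monotonicity all
  would fail at the maximum of these.\<close>

lemma uniform_choice:
  fixes P :: "'a \<Rightarrow> nat \<Rightarrow> bool"
  assumes "finite A" "\<And>k. \<exists>i\<in>A. P i k" "\<And>i k l. P i l \<Longrightarrow> k \<le> l \<Longrightarrow> P i k"
  shows "\<exists>i\<in>A. \<forall>k. P i k"
proof (rule ccontr)
  assume "\<not> ?thesis"
  then obtain h where h: "\<And>i. i \<in> A \<Longrightarrow> \<not> P i (h i)" by metis
  obtain i where i: "i \<in> A" "P i (Max (h ` A))" using assms(2) by blast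
  have "h i \<le> Max (h ` A)" using \<open>finite A\<close> i(1) by simp
  with assms(3) i h show False by blast
qed

theorem theorem1p5:
  fixes k\<^sub>1 k\<^sub>2 :: real and r :: nat and Q :: "nat \<Rightarrow> rat set"
  assumes "k\<^sub>1 < k\<^sub>2"
    and "r \<ge> 1"
    and "(UNIV :: rat set) = (\<Union>i\<in>{1..r}. Q i)"
  shows "\<exists>i\<^sub>0\<in>{1..r}. \<forall>k::nat. k \<ge> 1 \<longrightarrow>
    (\<exists>\<alpha> \<beta> \<gamma> :: rat. \<beta> \<notin> \<int> \<and> \<gamma> \<in> \<int> - {0} \<and>
       rat_dom_pos \<beta> = {} \<and> rat_dom_neg \<gamma> = {} \<and>
       real_of_int (Max (rat_dom_neg \<beta>)) < k\<^sub>1 \<and> k\<^sub>2 < real_of_int (Min (rat_dom_pos \<gamma>)) \<and>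
       (\<forall>p q :: int. 0 \<le> p \<and> p \<le> int k \<and> 0 \<le> q \<and> q \<le> int k \<longrightarrow>
          \<alpha> + of_int p * \<beta> + of_int q * \<gamma> \<in> Q i\<^sub>0))"
proof -
  \<comment> \<open>Only \<open>grid\<close> depends on the size \<open>k\<close>, so monotonicity
    in \<open>k\<close> concerns \<open>grid\<close> alone.\<close>
  define adm where "adm \<beta> \<gamma> \<longleftrightarrow> \<beta> \<notin> \<int> \<and> \<gamma> \<in> \<int> - {0} \<and>
       rat_dom_pos \<beta> = {} \<and> rat_dom_neg \<gamma> = {} \<and>
       real_of_int (Max (rat_dom_neg \<beta>)) < k\<^sub>1 \<and> k\<^sub>2 < real_of_int (Min (rat_dom_pos \<gamma>))"
    for \<beta> \<gamma> :: rat
  define grid where "grid i k \<alpha> \<beta> \<gamma> \<longleftrightarrow> (\<forall>p q :: int. 0 \<le> p \<and> p \<le> int k \<and> 0 \<le> q \<and> q \<le> int k \<longrightarrow>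
          \<alpha> + of_int p * \<beta> + of_int q * \<gamma> \<in> Q i)" for i k and \<alpha> \<beta> \<gamma> :: rat
  define P where "P i k \<longleftrightarrow> (\<exists>\<alpha> \<beta> \<gamma>. adm \<beta> \<gamma> \<and> grid i k \<alpha> \<beta> \<gamma>)" for i k
  have "\<exists>i\<in>{1..r}. \<forall>k. P i k"
  proof (rule uniform_choice)
    fix k
    have "\<forall>x. \<exists>i\<in>{1..r}. x \<in> Q i" using assms(3) by blast
    \<comment> \<open>The sets \<open>Q i\<close> may overlap; \<open>\<chi>\<close> selects one of
      them for each rational.\<close>
    then obtain \<chi> where \<chi>: "\<And>x. \<chi> x \<in> {1..r}" "\<And>x. x \<in> Q (\<chi> x)" by metis
    obtain W where W: "\<And>f::nat \<Rightarrow> nat \<Rightarrow> nat. (\<forall>x y. f x y \<in> {1..r}) \<Longrightarrow>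
      (\<exists>a b d e. 0 < d \<and> d \<le> W \<and> 0 < e \<and> e \<le> W \<and>
        (\<forall>i\<le>k. \<forall>j\<le>k. f (a + i * d) (b + j * e) = f a b))"
      using monochromatic_grid[of "{1..r}" k] by auto
    obtain n :: nat where n: "max \<bar>k\<^sub>1\<bar> \<bar>k\<^sub>2\<bar> < real n" using reals_Archimedean2 by blast
    \<comment> \<open>\<open>n\<close> secures the conditions on \<open>k\<^sub>1\<close> and
      \<open>k\<^sub>2\<close>; \<open>W\<close> makes both widths legal digits at position
      \<open>s\<close>.\<close>
    define s where "s = max n W"
    have s: "- real s < k\<^sub>1" "k\<^sub>2 < real s" "W \<le> s" using n by (auto simp: s_def)
    define u v :: rat where "u = (-1) ^ s / fact (s + 1)" and "v = (-1) ^ (s + 1) * fact s"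
    obtain a b d e where g: "0 < d" "d \<le> W" "0 < e" "e \<le> W" and
      mono: "\<forall>i\<le>k. \<forall>j\<le>k. \<chi> (of_nat (a + i * d) * u + of_nat (b + j * e) * v)
        = \<chi> (of_nat a * u + of_nat b * v)"
      using W[of "\<lambda>x y. \<chi> (of_nat x * u + of_nat y * v)"] \<chi>(1) by blast
    define \<alpha> \<beta> \<gamma> where "\<alpha> = of_nat a * u + of_nat b * v" and "\<beta> = of_nat d * u" and "\<gamma> = of_nat e * v"
    have in_Q: "\<alpha> + of_int p * \<beta> + of_int q * \<gamma> \<in> Q (\<chi> \<alpha>)"
      if pq: "0 \<le> p \<and> p \<le> int k \<and> 0 \<le> q \<and> q \<le> int k" for p q
    proof -
      obtain i j where ij: "p = int i" "q = int j" using pq nonneg_int_cases by metis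
      have eq: "\<alpha> + of_int p * \<beta> + of_int q * \<gamma> = of_nat (a + i * d) * u + of_nat (b + j * e) * v"
        unfolding ij \<alpha>_def \<beta>_def \<gamma>_def of_int_of_nat_eq of_nat_add of_nat_mult
        by (simp only: algebra_simps)
      have "i \<le> k" "j \<le> k" using pq ij by auto
      then have "\<chi> (\<alpha> + of_int p * \<beta> + of_int q * \<gamma>) = \<chi> \<alpha>"
        unfolding eq unfolding \<alpha>_def by (rule mono[rule_format])
      then show ?thesis using \<chi>(2) by metis
    qed
    have "d \<le> s" "e \<le> s" using g s by auto
    note rat_dom_single_neg[OF g(1) this(1), folded u_def, folded \<beta>_def]
      rat_dom_single_pos[OF g(3) this(2), folded v_def, folded \<gamma>_def]
    then have "adm \<beta> \<gamma>" unfolding adm_def using s(1,2) by simp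
    moreover have "grid (\<chi> \<alpha>) k \<alpha> \<beta> \<gamma>" unfolding grid_def using in_Q by blast
    ultimately have "P (\<chi> \<alpha>) k" unfolding P_def by blast
    with \<chi>(1) show "\<exists>i\<in>{1..r}. P i k" by blast
  next
    fix i k l :: nat
    assume "P i l" "k \<le> l"
    have "grid i k \<alpha> \<beta> \<gamma>" if "grid i l \<alpha> \<beta> \<gamma>" for \<alpha> \<beta> \<gamma>
      using that \<open>k \<le> l\<close> unfolding grid_def by simp
    with \<open>P i l\<close> show "P i k" unfolding P_def by blast
  qed simp
  then show ?thesis unfolding P_def adm_def grid_def by (simp only: conj_assoc) blast
qed

end
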